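(* Let $C$ be a planar closed curve, and let $c:[0,|C|)\to C$ be an arc-length parameterization. Then the following two statements are equivalent: 1. Both of the following hold: (a) whenever $c$ is differentiable in $t$ and in $t+|C|/2$, $\dot m(t)\neq 0$ and $\dot c^*(t)\ne 0$, the halving chord $c(t)c(t+|C|/2)$ is tangent to the midpoint curve at $m(t)$; (b) if the midpoint stays at $m\in\mathbb{R}^2$ on a whole interval $(t_1,t_2)$ (i.e. $m(t)=m$ for all $t\in(t_1,t_2)$), then the halving pairs $c(t),c(t+|C|/2)$, $t\in(t_1,t_2)$, are located on the circle with radius $h(C)/2$ and center $m$. 2. $C$ is a cycle of constant halving distance.
   Context: Closed curves (cycles) are simple closed curves in $\mathbb{R}^2$, assumed piecewise continuously differentiable; $|C|$ is the length of $C$, and parameters $t+|C|/2$ are taken modulo $|C|$. A halving pair consists of two points $c(t)$ and $c(t+|C|/2)$, which divide $C$ into two parts of equal length; the segment between them is a halving chord and its length is the corresponding halving distance. $h(C)$ and $H(C)$ denote the minimum and maximum halving distance; $C$ has constant halving distance if $h(C)=H(C)$. The midpoint curve $M$ is given by $m(t)=\frac12\left(c(t)+c(t+|C|/2)\right)$, and $c^*(t)=\frac12\left(c(t)-c(t+|C|/2)\right)$. The halving chord at $t$ is tangent to the midpoint curve at $m(t)$ if its direction $c(t)-c(t+|C|/2)$ is parallel to $\dot m(t)$. *)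

theory Defs
  imports "HOL-Analysis.Analysis"
begin

definition C1_on_segment :: "(real \<Rightarrow> real^2) \<Rightarrow> real \<Rightarrow> real \<Rightarrow> bool" where
  "C1_on_segment c a b \<longleftrightarrow>
    (\<exists>D. continuous_on {a..b} D \<and>
         (\<forall>t\<in>{a..b}. (c has_vector_derivative D t) (at t within {a..b})))"

text \<open>
  Every piece is continuously differentiable up to and including its end points, with one-sided
  derivatives there. The library predicate \<open>piecewise_C1_differentiable_on\<close> is weaker: it
  constrains the derivative only off a finite set, so the derivative may oscillate without limit
  at a break point, and the derivative of a unit-speed curve at such a point may exist and have
  norm less than 1.
\<close>

definition piecewise_C1 :: "(real \<Rightarrow> real^2) \<Rightarrow> real \<Rightarrow> real \<Rightarrow> bool" where
  "piecewise_C1 c a b \<longleftrightarrow>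
    (\<exists>(n::nat) s. s 0 = a \<and> s n = b \<and>
         (\<forall>i<n. s i < s (Suc i) \<and> C1_on_segment c (s i) (s (Suc i))))"

text \<open>
  The values of the derivative at the finitely many break points do not affect the integral.
\<close>

definition curve_length :: "(real \<Rightarrow> real^2) \<Rightarrow> real \<Rightarrow> real \<Rightarrow> real" where
  "curve_length c a b = integral {a..b} (\<lambda>u. norm (vector_derivative c (at u)))"

text \<open>
  A parameterization on \<open>[0, L)\<close> is represented by its \<open>L\<close>-periodic extension to the real line,
  so that parameters are implicitly taken modulo \<open>L\<close>.
\<close>

definition closed_curve_param :: "(real^2) set \<Rightarrow> real \<Rightarrow> (real \<Rightarrow> real^2) \<Rightarrow> bool" where
  "closed_curve_param C L c \<longleftrightarrow>
    0 < L \<and> (\<forall>t. c (t + L) = c t) \<and> piecewise_C1 c 0 L \<and>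
    inj_on c {0..<L} \<and> c ` {0..<L} = C"

text \<open>
  Taking \<open>s = 0\<close> and \<open>t = L\<close> in the last condition shows that \<open>L\<close> is the length of the curve.
\<close>

definition arc_length_param :: "(real^2) set \<Rightarrow> real \<Rightarrow> (real \<Rightarrow> real^2) \<Rightarrow> bool" where
  "arc_length_param C L c \<longleftrightarrow>
    closed_curve_param C L c \<and>
    (\<forall>s t. 0 \<le> s \<and> s \<le> t \<and> t \<le> L \<longrightarrow> curve_length c s t = t - s)"

definition halving_distance :: "real \<Rightarrow> (real \<Rightarrow> real^2) \<Rightarrow> real \<Rightarrow> real" where
  "halving_distance L c t = dist (c t) (c (t + L/2))"

text \<open>
  The infimum and supremum are attained; see \<open>min_halving_distance_attained\<close> and
  \<open>max_halving_distance_attained\<close> below.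
\<close>

definition min_halving_distance :: "real \<Rightarrow> (real \<Rightarrow> real^2) \<Rightarrow> real" where
  "min_halving_distance L c = (INF t\<in>{0..<L}. halving_distance L c t)"

definition max_halving_distance :: "real \<Rightarrow> (real \<Rightarrow> real^2) \<Rightarrow> real" where
  "max_halving_distance L c = (SUP t\<in>{0..<L}. halving_distance L c t)"

definition constant_halving_distance :: "real \<Rightarrow> (real \<Rightarrow> real^2) \<Rightarrow> bool" where
  "constant_halving_distance L c \<longleftrightarrow> min_halving_distance L c = max_halving_distance L c"

definition midpoint_curve :: "real \<Rightarrow> (real \<Rightarrow> real^2) \<Rightarrow> real \<Rightarrow> real^2" where
  "midpoint_curve L c t = (1/2) *\<^sub>R (c t + c (t + L/2))"

definition cstar :: "real \<Rightarrow> (real \<Rightarrow> real^2) \<Rightarrow> real \<Rightarrow> real^2" where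
  "cstar L c t = (1/2) *\<^sub>R (c t - c (t + L/2))"

definition parallel :: "real^2 \<Rightarrow> real^2 \<Rightarrow> bool" where
  "parallel u v \<longleftrightarrow> (\<exists>k. k \<noteq> 0 \<and> u = k *\<^sub>R v)"

definition chord_tangent_to_midpoint_curve ::
    "real \<Rightarrow> (real \<Rightarrow> real^2) \<Rightarrow> real \<Rightarrow> bool" where
  "chord_tangent_to_midpoint_curve L c t \<longleftrightarrow>
    parallel (c t - c (t + L/2)) (vector_derivative (midpoint_curve L c) (at t))"

lemma piecewise_C1_continuous_on:
  assumes "piecewise_C1 c a b"
  shows "continuous_on {a..b} c"
proof -
  obtain n s where s: "s 0 = a" "s n = b"
    "\<And>i. i < n \<Longrightarrow> s i < s (Suc i) \<and> C1_on_segment c (s i) (s (Suc i))"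
    using assms unfolding piecewise_C1_def by blast
  have "s 0 \<le> s k \<and> continuous_on {s 0..s k} c" if "k \<le> n" for k
    using that
  proof (induction k)
    case (Suc k)
    have lt: "s k < s (Suc k)" and C1: "C1_on_segment c (s k) (s (Suc k))"
      using s(3)[of k] Suc.prems by auto
    have "continuous_on {s k..s (Suc k)} c"
      using C1 unfolding C1_on_segment_def
      by (meson continuous_on_eq_continuous_within has_vector_derivative_continuous)
    moreover have "s 0 \<le> s k" "continuous_on {s 0..s k} c" using Suc by auto
    moreover from this have "{s 0..s (Suc k)} = {s 0..s k} \<union> {s k..s (Suc k)}"
      using lt by auto
    ultimately show ?case using lt by (auto intro: continuous_on_closed_Un)
  qed auto
  then show ?thesis using s by auto
qed

lemma closed_curve_param_continuous:
  assumes "closed_curve_param C L c"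
  shows "continuous_on {0..L} (halving_distance L c)"
    and "halving_distance L c L = halving_distance L c 0"
proof -
  have L: "0 < L" and per: "\<And>t. c (t + L) = c t" and "piecewise_C1 c 0 L"
    using assms unfolding closed_curve_param_def by auto
  then have c: "continuous_on {0..L} c" by (simp add: piecewise_C1_continuous_on)
  have "continuous_on {L..2*L} (\<lambda>t. c (t - L))"
    by (rule continuous_on_compose2[OF c]) (auto intro!: continuous_intros)
  moreover have "c (t - L) = c t" for t using per[of "t - L"] by simp
  ultimately have "continuous_on {L..2*L} c" by simp
  then have "continuous_on ({0..L} \<union> {L..2*L}) c"
    using c by (intro continuous_on_closed_Un) auto
  moreover have "{0..L} \<union> {L..2*L} = {0..2*L}" using L by auto
  ultimately have c2: "continuous_on {0..2*L} c" by simp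
  have "continuous_on {0..L} (\<lambda>t. c (t + L/2))"
    by (rule continuous_on_compose2[OF c2]) (use L in \<open>auto intro!: continuous_intros\<close>)
  then show "continuous_on {0..L} (halving_distance L c)"
    unfolding halving_distance_def using c by (intro continuous_intros)
  show "halving_distance L c L = halving_distance L c 0"
    unfolding halving_distance_def using per[of 0] per[of "L/2"] by (simp add: add.commute)
qed

lemma min_halving_distance_attained:
  assumes "closed_curve_param C L c"
  shows "\<exists>t\<in>{0..<L}. min_halving_distance L c = halving_distance L c t \<and>
    (\<forall>s\<in>{0..<L}. halving_distance L c t \<le> halving_distance L c s)"
proof -
  have L: "0 < L" using assms unfolding closed_curve_param_def by auto
  then obtain u where u: "u \<in> {0..L}"
    "\<forall>s\<in>{0..L}. halving_distance L c u \<le> halving_distance L c s"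
    using continuous_attains_inf[OF compact_Icc _ closed_curve_param_continuous(1)[OF assms]]
    by auto
  define t where "t = (if u = L then 0 else u)"
  have t: "t \<in> {0..<L}" "halving_distance L c t = halving_distance L c u"
    using u L closed_curve_param_continuous(2)[OF assms] by (auto simp: t_def)
  then have le: "\<forall>s\<in>{0..<L}. halving_distance L c t \<le> halving_distance L c s"
    using u by auto
  then have "min_halving_distance L c = halving_distance L c t"
    unfolding min_halving_distance_def using t(1)
    by (intro cInf_eq_minimum) auto
  with t le show ?thesis by blast
qed

lemma max_halving_distance_attained:
  assumes "closed_curve_param C L c"
  shows "\<exists>t\<in>{0..<L}. max_halving_distance L c = halving_distance L c t \<and>
    (\<forall>s\<in>{0..<L}. halving_distance L c s \<le> halving_distance L c t)"
proof -
  have L: "0 < L" using assms unfolding closed_curve_param_def by auto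
  then obtain u where u: "u \<in> {0..L}"
    "\<forall>s\<in>{0..L}. halving_distance L c s \<le> halving_distance L c u"
    using continuous_attains_sup[OF compact_Icc _ closed_curve_param_continuous(1)[OF assms]]
    by auto
  define t where "t = (if u = L then 0 else u)"
  have t: "t \<in> {0..<L}" "halving_distance L c t = halving_distance L c u"
    using u L closed_curve_param_continuous(2)[OF assms] by (auto simp: t_def)
  then have le: "\<forall>s\<in>{0..<L}. halving_distance L c s \<le> halving_distance L c t"
    using u by auto
  then have "max_halving_distance L c = halving_distance L c t"
    unfolding max_halving_distance_def using t(1)
    by (intro cSup_eq_maximum) auto
  with t le show ?thesis by blast
qed

end

theory Submission
  imports Defs
begin

text \<open>
  Where \<open>c\<close> is differentiable at \<open>t\<close> and at \<open>t + L/2\<close>, with unit tangents \<open>a\<close> and \<open>b\<close>, the vectors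
  \<open>m' = (a + b)/2\<close> and \<open>c*' = (a - b)/2\<close> are orthogonal. The halving distance is twice \<open>norm c*\<close>,
  so it is stationary at \<open>t\<close> iff \<open>c*\<close> is orthogonal to \<open>c*'\<close>, which in the plane means that the
  chord is parallel to \<open>m'\<close> whenever \<open>m'\<close> and \<open>c*'\<close> do not vanish. If \<open>c*\<close> and \<open>c*'\<close> were not
  orthogonal at some regular \<open>t\<close>, the same would hold near \<open>t\<close>; the tangency condition then forces
  \<open>m' = 0\<close> there, so the midpoint stays fixed and the circle condition makes \<open>norm c*\<close> constant, a
  contradiction. A continuous function with zero derivative off a finite set is constant.
\<close>

section \<open>Parallel vectors in the plane\<close>

lemma parallel_if_orthogonal_to_common:
  fixes u v w :: "real^2"
  assumes "w \<noteq> 0" "u \<noteq> 0" "v \<noteq> 0" "u \<bullet> w = 0" "v \<bullet> w = 0"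
  shows "parallel u v"
proof -
  have comp: "x = 0 \<longleftrightarrow> x$1 = 0 \<and> x$2 = 0" for x :: "real^2"
    by (simp add: vec_eq_iff forall_2)
  have uw: "u$1 * w$1 + u$2 * w$2 = 0" and vw: "v$1 * w$1 + v$2 * w$2 = 0"
    using assms(4,5) by (simp_all add: inner_vec_def sum_2)
  \<comment> \<open>The determinant of \<open>u\<close> and \<open>v\<close> annihilates
    \<open>w\<close>, which is not zero; this is where dimension two enters.\<close>
  have "(u$1 * v$2 - u$2 * v$1) * w$1 = 0" "(u$1 * v$2 - u$2 * v$1) * w$2 = 0"
    using uw vw by algebra+
  then have det: "u$1 * v$2 = u$2 * v$1"
    using assms(1) comp[of w] by auto
  \<comment> \<open>\<open>k\<close> is the coefficient of the orthogonal projection of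
    \<open>u\<close> onto \<open>v\<close>; the vanishing determinant makes the projection equal to
    \<open>u\<close>.\<close>
  define k where "k = (u \<bullet> v) / (v \<bullet> v)"
  have "v \<bullet> v \<noteq> 0" using assms(3) by simp
  then have "k * (v \<bullet> v) = u \<bullet> v" by (simp add: k_def)
  then have k: "k * (v$1 * v$1 + v$2 * v$2) = u$1 * v$1 + u$2 * v$2"
    and vv: "v$1 * v$1 + v$2 * v$2 \<noteq> 0"
    using \<open>v \<bullet> v \<noteq> 0\<close> by (simp_all add: inner_vec_def sum_2)
  have "(u$1 - k * v$1) * (v$1 * v$1 + v$2 * v$2) = 0"
    "(u$2 - k * v$2) * (v$1 * v$1 + v$2 * v$2) = 0"
    using k det by algebra+
  then have "u$1 = k * v$1" "u$2 = k * v$2" using vv by auto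
  then have "u = k *\<^sub>R v" by (simp add: vec_eq_iff forall_2)
  moreover from this have "k \<noteq> 0" using assms(2) by auto
  ultimately show ?thesis unfolding parallel_def by blast
qed

section \<open>Local regularity away from break points\<close>

text \<open>A continuous derivative on a whole ball is recorded, not just differentiability at
  \<open>t\<close>, so that an inner product with the derivative that is nonzero at \<open>t\<close>
  stays nonzero nearby.\<close>

definition C1_near :: "(real \<Rightarrow> 'a::real_normed_vector) \<Rightarrow> real \<Rightarrow> bool" where
  "C1_near f t \<longleftrightarrow>
    (\<exists>D e. 0 < e \<and> continuous_on (ball t e) D \<and>
      (\<forall>x\<in>ball t e. (f has_vector_derivative D x) (at x)))"

lemma has_vector_derivative_shift_iff:
  fixes f :: "real \<Rightarrow> 'a::real_normed_vector"
  shows "((\<lambda>x. f (x + a)) has_vector_derivative d) (at t) \<longleftrightarrow>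
    (f has_vector_derivative d) (at (t + a))"
proof -
  have shift: "((\<lambda>x. g (x + b)) has_vector_derivative d) (at s)"
    if "(g has_vector_derivative d) (at (s + b))" for g :: "real \<Rightarrow> 'a" and b s
  proof -
    have "((g \<circ> (\<lambda>x. x + b)) has_vector_derivative 1 *\<^sub>R d) (at s)"
      by (rule vector_diff_chain_at) (use that in \<open>auto intro!: derivative_eq_intros\<close>)
    then show ?thesis by (simp add: o_def)
  qed
  show ?thesis
    using shift[of f t a] shift[of "\<lambda>x. f (x + a)" "t + a" "- a"] by auto
qed

lemma C1_near_shift:
  assumes "C1_near f (t + a)"
  shows "C1_near (\<lambda>x. f (x + a)) t"
proof -
  obtain D e where De: "0 < e" "continuous_on (ball (t + a) e) D"
    "\<forall>x\<in>ball (t + a) e. (f has_vector_derivative D x) (at x)"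
    using assms unfolding C1_near_def by blast
  have "x + a \<in> ball (t + a) e" if "x \<in> ball t e" for x
    using that by (simp add: dist_real_def)
  then have "continuous_on (ball t e) (\<lambda>x. D (x + a))"
    "\<forall>x\<in>ball t e. ((\<lambda>x. f (x + a)) has_vector_derivative D (x + a)) (at x)"
    using De by (auto simp: has_vector_derivative_shift_iff
        intro!: continuous_on_compose2[OF De(2)] continuous_intros)
  then show ?thesis using De(1) unfolding C1_near_def by blast
qed

lemma C1_near_lincomb:
  assumes "C1_near f t" "C1_near g t"
  shows "C1_near (\<lambda>x. p *\<^sub>R f x + q *\<^sub>R g x) t"
proof -
  obtain D d where D: "0 < d" "continuous_on (ball t d) D"
    "\<forall>x\<in>ball t d. (f has_vector_derivative D x) (at x)"
    using assms(1) unfolding C1_near_def by blast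
  obtain E e where E: "0 < e" "continuous_on (ball t e) E"
    "\<forall>x\<in>ball t e. (g has_vector_derivative E x) (at x)"
    using assms(2) unfolding C1_near_def by blast
  have "continuous_on (ball t (min d e)) (\<lambda>x. p *\<^sub>R D x + q *\<^sub>R E x)"
    by (intro continuous_intros continuous_on_subset[OF D(2)] continuous_on_subset[OF E(2)]) auto
  moreover have "\<forall>x\<in>ball t (min d e).
      ((\<lambda>x. p *\<^sub>R f x + q *\<^sub>R g x) has_vector_derivative p *\<^sub>R D x + q *\<^sub>R E x) (at x)"
    using D E by (auto intro!: has_vector_derivative_add
        bounded_linear.has_vector_derivative[OF bounded_linear_scaleR_right])
  ultimately show ?thesis unfolding C1_near_def using D(1) E(1)
    by (intro exI[of _ "\<lambda>x. p *\<^sub>R D x + q *\<^sub>R E x"] exI[of _ "min d e"]) auto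
qed

lemma C1_near_C1_on_segment:
  assumes "C1_on_segment c a b" "a < t" "t < b"
  shows "C1_near c t"
proof -
  obtain D where D: "continuous_on {a..b} D"
    "\<forall>t\<in>{a..b}. (c has_vector_derivative D t) (at t within {a..b})"
    using assms(1) unfolding C1_on_segment_def by blast
  define e where "e = min (t - a) (b - t)"
  have sub: "ball t e \<subseteq> {a<..<b}" by (auto simp: e_def dist_real_def)
  have "(c has_vector_derivative D x) (at x)" if "x \<in> ball t e" for x
  proof -
    have "x \<in> {a<..<b}" using that sub by blast
    then show ?thesis using bspec[OF D(2), of x] at_within_Icc_at[of a x b] by auto
  qed
  moreover have "continuous_on (ball t e) D"
    by (rule continuous_on_subset[OF D(1)]) (use sub in fastforce)
  moreover have "0 < e" using assms by (simp add: e_def)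
  ultimately show ?thesis unfolding C1_near_def by blast
qed

text \<open>A break point below \<open>b\<close> is assigned to the piece starting there. Hence even
  break points lie in a nondegenerate closed piece, from which a one-sided derivative can be read
  off.\<close>

lemma piecewise_C1_pieces:
  assumes "piecewise_C1 c a b"
  obtains S where "finite S"
    "\<And>t. t \<in> {a..b} \<Longrightarrow> t \<notin> S \<Longrightarrow> C1_near c t"
    "\<And>t. a \<le> t \<Longrightarrow> t < b \<Longrightarrow> \<exists>p q. a \<le> p \<and> p \<le> t \<and> t < q \<and> q \<le> b \<and> C1_on_segment c p q"
proof -
  obtain n s where s: "s 0 = a" "s n = b"
    and C1: "\<And>i. i < n \<Longrightarrow> s i < s (Suc i) \<and> C1_on_segment c (s i) (s (Suc i))"
    using assms unfolding piecewise_C1_def by blast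
  have mono: "s i \<le> s j" if "i \<le> j" "j \<le> n" for i j
    using that
  proof (induction j rule: dec_induct)
    case (step k)
    then show ?case using C1[of k] by auto
  qed simp
  have piece: "\<exists>i<n. s i \<le> t \<and> t < s (Suc i)" if "a \<le> t" "t < b" for t
  proof -
    have "\<exists>i<k. s i \<le> t \<and> t < s (Suc i)" if "k \<le> n" "t < s k" for k
      using that
    proof (induction k)
      case 0
      then show ?case using s \<open>a \<le> t\<close> by simp
    next
      case (Suc k)
      then show ?case by (cases "t < s k") (auto intro: less_SucI)
    qed
    then show ?thesis using s that by blast
  qed
  show thesis
  proof
    show "finite (s ` {..n})" by simp
    show "C1_near c t" if "t \<in> {a..b}" "t \<notin> s ` {..n}" for t
    proof -
      have "t \<noteq> b" using that s by auto
      then obtain i where i: "i < n" "s i \<le> t" "t < s (Suc i)" using piece[of t] \<open>t \<in> {a..b}\<close> by auto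
      moreover have "s i \<noteq> t" using that i by auto
      ultimately show ?thesis using C1[of i] by (auto intro: C1_near_C1_on_segment)
    qed
    show "\<exists>p q. a \<le> p \<and> p \<le> t \<and> t < q \<and> q \<le> b \<and> C1_on_segment c p q" if "a \<le> t" "t < b" for t
    proof -
      obtain i where i: "i < n" "s i \<le> t" "t < s (Suc i)" using piece[OF \<open>a \<le> t\<close> \<open>t < b\<close>] by blast
      then show ?thesis using C1[of i] mono[of 0 i] mono[of "Suc i" n] s by fastforce
    qed
  qed
qed

section \<open>Periodicity, unit speed and exceptional parameters\<close>

lemma periodic_add_int:
  fixes c :: "real \<Rightarrow> 'a"
  assumes per: "\<And>t. c (t + L) = c t"
  shows "c (t + of_int k * L) = c t"
proof (induction k rule: int_induct[where k = 0])
  case (step1 i)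
  then show ?case using per[of "t + of_int i * L"] by (simp add: algebra_simps)
next
  case (step2 i)
  then show ?case using per[of "t + of_int (i - 1) * L"] by (simp add: algebra_simps)
qed simp

lemma period_representative:
  fixes t L :: real
  assumes "0 < L"
  obtains k :: int where "t + of_int k * L \<in> {0..<L}"
proof
  have "of_int \<lfloor>t / L\<rfloor> * L \<le> t" "t < (of_int \<lfloor>t / L\<rfloor> + 1) * L"
    using assms floor_divide_lower floor_divide_upper by blast+
  then show "t + of_int (- \<lfloor>t / L\<rfloor>) * L \<in> {0..<L}" by (simp add: algebra_simps)
qed

text \<open>By the fundamental theorem of calculus, \<open>norm (D t)\<close> is the derivative of
  the length from \<open>p\<close> to \<open>t\<close>, which is \<open>t - p\<close>.
  Differentiating within the closed segment includes its end points.\<close>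

lemma unit_speed_on_segment:
  assumes len: "\<And>s t. p \<le> s \<Longrightarrow> s \<le> t \<Longrightarrow> t \<le> q \<Longrightarrow> curve_length c s t = t - s"
    and D: "continuous_on {p..q} D"
      "\<forall>t\<in>{p..q}. (c has_vector_derivative D t) (at t within {p..q})"
    and "p < q" "t \<in> {p..q}"
  shows "norm (D t) = 1"
proof -
  have cn: "continuous_on {p..q} (\<lambda>u. norm (D u))" using D(1) by (intro continuous_intros)
  have int: "integral {p..u} (\<lambda>u. norm (D u)) = u - p" if "u \<in> {p..q}" for u
  proof -
    have "integral {p..u} (\<lambda>x. norm (D x)) = integral {p..u} (\<lambda>x. norm (vector_derivative c (at x)))"
    \<comment> \<open>At \<open>p\<close> and \<open>q\<close> the two-sided derivative of
      \<open>c\<close> may fail to exist or differ from \<open>D\<close>; two points are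
      negligible.\<close>
    proof (rule integral_spike[of "{p, q}"])
      fix x assume "x \<in> {p..u} - {p, q}"
      then have x: "p < x" "x < q" using that by auto
      then have "(c has_vector_derivative D x) (at x)"
        using bspec[OF D(2), of x] at_within_Icc_at[of p x q] by auto
      then show "norm (vector_derivative c (at x)) = norm (D x)"
        by (simp add: vector_derivative_at)
    qed (simp add: negligible_insert)
    also have "\<dots> = u - p" using len[of p u] that by (simp add: curve_length_def)
    finally show ?thesis .
  qed
  have "((\<lambda>u. integral {p..u} (\<lambda>u. norm (D u))) has_vector_derivative norm (D t))
      (at t within {p..q})"
    by (rule integral_has_vector_derivative[OF cn]) (use assms in simp)
  then have "((\<lambda>u. u - p) has_vector_derivative norm (D t)) (at t within {p..q})"
    by (rule has_vector_derivative_transform[OF assms(5), rotated]) (simp add: int)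
  moreover have "((\<lambda>u. u - p) has_vector_derivative 1) (at t within {p..q})"
    by (auto intro!: derivative_eq_intros)
  ultimately show ?thesis
    using vector_derivative_unique_within_closed_interval[of p q t] assms(4,5) by auto
qed

text \<open>After a shift into the basic period, a two-sided derivative must agree with the
  one-sided derivative of the piece to the right, so break points at which \<open>c\<close> happens
  to be differentiable are covered too.\<close>

lemma arc_length_param_unit_speed:
  assumes "arc_length_param C L c" and d: "(c has_vector_derivative d) (at t)"
  shows "norm d = 1"
proof -
  have L: "0 < L" and per: "\<And>t. c (t + L) = c t" and pw: "piecewise_C1 c 0 L"
    and len: "\<And>s t. 0 \<le> s \<Longrightarrow> s \<le> t \<Longrightarrow> t \<le> L \<Longrightarrow> curve_length c s t = t - s"
    using assms(1) unfolding arc_length_param_def closed_curve_param_def by auto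
  obtain k :: int where k: "t + of_int k * L \<in> {0..<L}" using period_representative[OF L] .
  define u where "u = t + of_int k * L"
  have u: "0 \<le> u" "u < L" using k by (auto simp: u_def)
  have "((\<lambda>x. c (x + of_int k * L)) has_vector_derivative d) (at t)"
    using d periodic_add_int[of c L, OF per] by simp
  then have du: "(c has_vector_derivative d) (at u)"
    unfolding has_vector_derivative_shift_iff u_def .
  obtain p q where pq: "0 \<le> p" "p \<le> u" "u < q" "q \<le> L" "C1_on_segment c p q"
    using piecewise_C1_pieces[OF pw] u by metis
  then obtain D where D: "continuous_on {p..q} D"
    "\<forall>t\<in>{p..q}. (c has_vector_derivative D t) (at t within {p..q})"
    unfolding C1_on_segment_def by blast
  have "(c has_vector_derivative d) (at u within {p..q})"
    using du by (rule has_vector_derivative_at_within)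
  moreover have "(c has_vector_derivative D u) (at u within {p..q})" using D pq by simp
  ultimately have "d = D u"
    using vector_derivative_unique_within_closed_interval[of p q u] pq by auto
  moreover have "norm (D u) = 1"
    by (rule unit_speed_on_segment[OF len D]) (use pq in auto)
  ultimately show ?thesis by simp
qed

lemma closed_curve_param_C1_near:
  assumes "closed_curve_param C L c"
  obtains S where "finite S" "\<And>t. t \<in> {0..L} - S \<Longrightarrow> C1_near c t \<and> C1_near c (t + L/2)"
proof -
  have L: "0 < L" and per: "\<And>t. c (t + L) = c t" and pw: "piecewise_C1 c 0 L"
    using assms unfolding closed_curve_param_def by auto
  have shift: "(\<lambda>x. c (x + - L)) = c" using per[of "_ - L"] by auto
  obtain S where S: "finite S" "\<And>t. t \<in> {0..L} \<Longrightarrow> t \<notin> S \<Longrightarrow> C1_near c t"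
    using piecewise_C1_pieces[OF pw] by metis
  show thesis
  proof
    \<comment> \<open>Regularity off \<open>S\<close> is known on \<open>{0..L}\<close> only. For
      \<open>t > L/2\<close> the parameter \<open>t + L/2\<close> is replaced by
      \<open>t - L/2\<close>, one period earlier, so both shifts of \<open>S\<close> are
      removed.\<close>
    show "finite (S \<union> (\<lambda>s. s - L/2) ` S \<union> (\<lambda>s. s + L/2) ` S)" using S by simp
    fix t assume t: "t \<in> {0..L} - (S \<union> (\<lambda>s. s - L/2) ` S \<union> (\<lambda>s. s + L/2) ` S)"
    have "t + L/2 \<notin> S" using t by force
    moreover have "t - L/2 \<notin> S" using t by force
    ultimately have "C1_near c (t + L/2)"
    proof (cases "t \<le> L/2")
      case False
      then have "C1_near c (t - L/2)" using S(2) t \<open>t - L/2 \<notin> S\<close> by auto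
      then have "C1_near (\<lambda>x. c (x + - L)) (t + L/2)"
        by (intro C1_near_shift) (simp add: field_simps)
      then show ?thesis unfolding shift .
    qed (use S(2) t in auto)
    then show "C1_near c t \<and> C1_near c (t + L/2)" using S(2) t by auto
  qed
qed

section \<open>Derivatives of the midpoint curve and of the half chord\<close>

lemma midpoint_cstar_derivs:
  assumes "(c has_vector_derivative a) (at t)" "(c has_vector_derivative b) (at (t + L/2))"
  shows "(midpoint_curve L c has_vector_derivative (1/2) *\<^sub>R (a + b)) (at t)"
    and "(cstar L c has_vector_derivative (1/2) *\<^sub>R (a - b)) (at t)"
  using assms unfolding midpoint_curve_def[abs_def] cstar_def[abs_def]
  by (auto intro!: bounded_linear.has_vector_derivative[OF bounded_linear_scaleR_right]
      has_vector_derivative_add has_vector_derivative_diff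
      simp: has_vector_derivative_shift_iff)

lemma midpoint_cstar_C1_near:
  assumes "C1_near c t" "C1_near c (t + L/2)"
  shows "C1_near (midpoint_curve L c) t" "C1_near (cstar L c) t"
proof -
  have "C1_near (\<lambda>x. c (x + L/2)) t" using assms(2) by (rule C1_near_shift)
  from C1_near_lincomb[OF assms(1) this, of "1/2" "1/2"]
    C1_near_lincomb[OF assms(1) this, of "1/2" "-1/2"]
  show "C1_near (midpoint_curve L c) t" "C1_near (cstar L c) t"
    unfolding midpoint_curve_def[abs_def] cstar_def[abs_def]
    by (simp_all add: scaleR_add_right scaleR_diff_right)
qed

text \<open>For tangents \<open>a\<close> and \<open>b\<close>, the inner product of
  \<open>a + b\<close> and \<open>a - b\<close> is the difference of their squared norms, which is
  zero at unit speed. The arc-length condition enters the theorem through this lemma.\<close>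

lemma midpoint_cstar_derivs_orthogonal:
  assumes "arc_length_param C L c" "c differentiable at t" "c differentiable at (t + L/2)"
  shows "vector_derivative (midpoint_curve L c) (at t) \<bullet> vector_derivative (cstar L c) (at t) = 0"
proof -
  obtain a b where ab: "(c has_vector_derivative a) (at t)" "(c has_vector_derivative b) (at (t + L/2))"
    using assms(2,3) by (auto simp: vector_derivative_works)
  then have "norm a = 1" "norm b = 1" using arc_length_param_unit_speed[OF assms(1)] by auto
  then have "a \<bullet> a = 1" "b \<bullet> b = 1" by (simp_all add: dot_square_norm)
  then have "(a + b) \<bullet> (a - b) = 0"
    by (simp add: inner_add_left inner_diff_right inner_commute[of b a])
  then show ?thesis
    using midpoint_cstar_derivs[OF ab] by (simp add: vector_derivative_at)
qed

section \<open>Constancy of the halving distance\<close>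

lemma halving_distance_eq_norm_cstar: "halving_distance L c t = 2 * norm (cstar L c t)"
  by (simp add: halving_distance_def cstar_def dist_norm)

lemma constant_halving_distance_iff:
  assumes "closed_curve_param C L c"
  shows "constant_halving_distance L c \<longleftrightarrow>
    (\<forall>t\<in>{0..<L}. halving_distance L c t = min_halving_distance L c)"
  using min_halving_distance_attained[OF assms] max_halving_distance_attained[OF assms]
  unfolding constant_halving_distance_def by (metis order_antisym)

text \<open>Periodicity carries the value to all reals. This serves the two-sided derivative at
  \<open>t = 0\<close> and the intervals of condition (b), which may lie anywhere on the
  line.\<close>

lemma constant_halving_distance_everywhere:
  assumes "closed_curve_param C L c" "constant_halving_distance L c"
  shows "halving_distance L c t = min_halving_distance L c"
proof -
  have L: "0 < L" and per: "\<And>t. c (t + L) = c t"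
    using assms unfolding closed_curve_param_def by auto
  obtain k :: int where k: "t + of_int k * L \<in> {0..<L}" using period_representative[OF L] .
  have "halving_distance L c (t + of_int k * L) = halving_distance L c t"
    using periodic_add_int[of c L t k, OF per] periodic_add_int[of c L "t + L/2" k, OF per]
    unfolding halving_distance_def by (simp add: add.assoc add.left_commute add.commute)
  then show ?thesis using constant_halving_distance_iff[OF assms(1)] assms(2) k by auto
qed

section \<open>Stationarity of the squared norm\<close>

lemma inner_self_has_derivative:
  fixes f :: "real \<Rightarrow> 'a::real_inner"
  assumes "(f has_vector_derivative d) (at t)"
  shows "((\<lambda>x. f x \<bullet> f x) has_vector_derivative 2 * (f t \<bullet> d)) (at t)"
proof -
  have "((\<lambda>x. f x \<bullet> f x) has_vector_derivative f t \<bullet> d + d \<bullet> f t) (at t)"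
    by (rule bounded_bilinear.has_vector_derivative[OF bounded_bilinear_inner assms assms])
  then show ?thesis by (simp add: inner_commute)
qed

text \<open>Here \<open>orth\<close> is what tangency yields and \<open>const\<close> is what the
  circle condition yields. The open set \<open>U\<close> is present because tangency is given on one
  period only. The square avoids the non-smoothness of the norm at the origin.\<close>

lemma stationary_norm:
  fixes m f :: "real \<Rightarrow> 'a::euclidean_space"
  assumes "C1_near m t" "C1_near f t" "open U" "t \<in> U"
    and orth: "\<And>x. x \<in> U \<Longrightarrow> m differentiable at x \<Longrightarrow> f differentiable at x \<Longrightarrow>
      vector_derivative m (at x) \<noteq> 0 \<Longrightarrow> f x \<bullet> vector_derivative f (at x) = 0"
    and const: "\<And>a b p. a < b \<Longrightarrow> \<forall>x\<in>{a<..<b}. m x = p \<Longrightarrow> \<exists>r. \<forall>x\<in>{a<..<b}. f x \<bullet> f x = r"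
  shows "((\<lambda>x. f x \<bullet> f x) has_vector_derivative 0) (at t)"
proof -
  obtain M d where M: "0 < d" "\<And>x. x \<in> ball t d \<Longrightarrow> (m has_vector_derivative M x) (at x)"
    using assms(1) unfolding C1_near_def by blast
  obtain F e where F: "0 < e" "continuous_on (ball t e) F"
    "\<And>x. x \<in> ball t e \<Longrightarrow> (f has_vector_derivative F x) (at x)"
    using assms(2) unfolding C1_near_def by blast
  have "f t \<bullet> F t = 0"
  proof (rule ccontr)
    assume neq: "f t \<bullet> F t \<noteq> 0"
    have "continuous_on (ball t e) f"
      using F(3) by (meson continuous_at_imp_continuous_on has_vector_derivative_continuous)
    then have "continuous_on (ball t e) (\<lambda>x. f x \<bullet> F x)" using F(2) by (intro continuous_intros)
    then have "isCont (\<lambda>x. f x \<bullet> F x) t" using F(1) by (simp add: continuous_on_eq_continuous_at)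
    then obtain d1 where d1: "0 < d1" "\<And>x. dist t x < d1 \<Longrightarrow> f x \<bullet> F x \<noteq> 0"
      using continuous_at_avoid[of t "\<lambda>x. f x \<bullet> F x" 0] neq by blast
    obtain d2 where d2: "0 < d2" "ball t d2 \<subseteq> U" using assms(3,4) open_contains_ball by blast
    \<comment> \<open>Within \<open>r\<close> the derivative formulas for \<open>m\<close> and
      \<open>f\<close> hold, the inner product stays nonzero, and \<open>U\<close> is not
      left.\<close>
    define r where "r = min (min d e) (min d1 d2)"
    have r: "0 < r" using M(1) F(1) d1(1) d2(1) by (simp add: r_def)
    have zero: "(m has_vector_derivative 0) (at x)" if "x \<in> ball t r" for x
    proof -
      have x: "x \<in> ball t d" "x \<in> ball t e" "dist t x < d1" "x \<in> U"
        using that d2(2) by (auto simp: r_def)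
      have "M x = 0"
        using orth[of x] x M(2)[of x] F(3)[of x] d1(2)[of x]
        by (metis differentiableI_vector vector_derivative_at)
      then show ?thesis using M(2)[OF x(1)] by simp
    qed
    obtain p where "\<And>x. x \<in> ball t r \<Longrightarrow> m x = p"
      using has_vector_derivative_zero_constant[of "ball t r" m]
      by (metis convex_ball has_vector_derivative_at_within zero)
    moreover have ball: "ball t r = {t - r<..<t + r}" by (auto simp: dist_real_def)
    ultimately obtain q where q: "\<And>x. x \<in> ball t r \<Longrightarrow> f x \<bullet> f x = q"
      using const[of "t - r" "t + r" p] r by auto
    \<comment> \<open>The squared norm is the constant \<open>q\<close> on the ball, so its
      derivative at \<open>t\<close> is also the derivative of a constant.\<close>
    have "((\<lambda>x. q) has_vector_derivative 2 * (f t \<bullet> F t)) (at t)"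
      by (rule has_vector_derivative_transform_within_open[of "\<lambda>x. f x \<bullet> f x" _ _ "ball t r"])
        (use q r F(1,3) in \<open>auto intro: inner_self_has_derivative\<close>)
    then have "2 * (f t \<bullet> F t) = 0"
      using vector_derivative_unique_at has_vector_derivative_const by blast
    then show False using neq by simp
  qed
  then show ?thesis using inner_self_has_derivative[OF F(3)[of t]] F(1) by simp
qed

theorem theorem3:
  fixes C :: "(real^2) set" and c :: "real \<Rightarrow> real^2" and L :: real
  assumes "arc_length_param C L c"
  shows "((\<forall>t\<in>{0..<L}.
             c differentiable (at t) \<and> c differentiable (at (t + L/2)) \<and>
             vector_derivative (midpoint_curve L c) (at t) \<noteq> 0 \<and>
             vector_derivative (cstar L c) (at t) \<noteq> 0 \<longrightarrow>
             chord_tangent_to_midpoint_curve L c t) \<and>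
          (\<forall>t1 t2 m. t1 < t2 \<and> (\<forall>t\<in>{t1<..<t2}. midpoint_curve L c t = m) \<longrightarrow>
             (\<forall>t\<in>{t1<..<t2}.
                c t \<in> sphere m (min_halving_distance L c / 2) \<and>
                c (t + L/2) \<in> sphere m (min_halving_distance L c / 2))))
         \<longleftrightarrow> constant_halving_distance L c"
proof -
  let ?m = "midpoint_curve L c" and ?f = "cstar L c"
  have cc: "closed_curve_param C L c" using assms by (simp add: arc_length_param_def)
  then have L: "0 < L" and inj: "inj_on c {0..<L}" and per: "\<And>t. c (t + L) = c t"
    unfolding closed_curve_param_def by auto
  have pair: "?m t + ?f t = c t" "?m t - ?f t = c (t + L/2)" for t
    by (simp_all add: midpoint_curve_def cstar_def vec_eq_iff field_simps)
  \<comment> \<open>The two end points are the midpoint plus and minus \<open>cstar\<close>, so a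
    single norm decides both memberships.\<close>
  have on_sphere: "c t \<in> sphere (?m t) r \<longleftrightarrow> norm (?f t) = r"
    "c (t + L/2) \<in> sphere (?m t) r \<longleftrightarrow> norm (?f t) = r" for t r
    by (simp_all only: pair[of t, symmetric]) (simp_all add: dist_norm)
  have sq: "?f x \<bullet> ?f x = (halving_distance L c x / 2)\<^sup>2" for x
    by (simp add: halving_distance_eq_norm_cstar power2_norm_eq_inner)
  show ?thesis
  proof (intro iffI conjI ballI allI impI; (elim conjE)?)
    assume tangent: "\<forall>t\<in>{0..<L}. c differentiable (at t) \<and> c differentiable (at (t + L/2)) \<and>
        vector_derivative ?m (at t) \<noteq> 0 \<and> vector_derivative ?f (at t) \<noteq> 0 \<longrightarrow>
        chord_tangent_to_midpoint_curve L c t"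
      and circle: "\<forall>t1 t2 m. t1 < t2 \<and> (\<forall>t\<in>{t1<..<t2}. ?m t = m) \<longrightarrow>
        (\<forall>t\<in>{t1<..<t2}. c t \<in> sphere m (min_halving_distance L c / 2) \<and>
          c (t + L/2) \<in> sphere m (min_halving_distance L c / 2))"
    have orth: "?f x \<bullet> vector_derivative ?f (at x) = 0"
      if x: "x \<in> {0<..<L}" "?m differentiable at x" "?f differentiable at x"
        "vector_derivative ?m (at x) \<noteq> 0" for x
    proof (cases "vector_derivative ?f (at x) = 0")
      case False
      \<comment> \<open>Sum and difference of \<open>?m\<close> and \<open>?f\<close> recover
        differentiability of \<open>c\<close> at both parameters, as the tangency condition
        requires.\<close>
      have "(?m has_vector_derivative vector_derivative ?m (at x)) (at x)"
        "(?f has_vector_derivative vector_derivative ?f (at x)) (at x)"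
        using x by (simp_all add: vector_derivative_works)
      note sum_diff = has_vector_derivative_add[OF this] has_vector_derivative_diff[OF this]
      from sum_diff(1) have c:
        "(c has_vector_derivative vector_derivative ?m (at x) + vector_derivative ?f (at x)) (at x)"
        by (simp add: pair)
      from sum_diff(2) have "((\<lambda>x. c (x + L/2)) has_vector_derivative
          vector_derivative ?m (at x) - vector_derivative ?f (at x)) (at x)"
        by (simp add: pair)
      then have c': "(c has_vector_derivative
          vector_derivative ?m (at x) - vector_derivative ?f (at x)) (at (x + L/2))"
        unfolding has_vector_derivative_shift_iff .
      have diff: "c differentiable at x" "c differentiable at (x + L/2)"
        using c c' by (auto intro: differentiableI_vector)
      then obtain k where "c x - c (x + L/2) = k *\<^sub>R vector_derivative ?m (at x)"
        using tangent x False unfolding chord_tangent_to_midpoint_curve_def parallel_def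
        by (metis atLeastLessThan_iff greaterThanLessThan_iff less_imp_le)
      \<comment> \<open>Tangency makes \<open>?f x\<close> a multiple of the derivative of
        \<open>?m\<close>, which is orthogonal to that of \<open>?f\<close>.\<close>
      then have "?f x = (1/2 * k) *\<^sub>R vector_derivative ?m (at x)" by (simp add: cstar_def)
      then show ?thesis using midpoint_cstar_derivs_orthogonal[OF assms diff] by simp
    qed simp
    have const: "\<exists>r. \<forall>x\<in>{a<..<b}. ?f x \<bullet> ?f x = r" if "a < b" "\<forall>x\<in>{a<..<b}. ?m x = p" for a b p
    proof -
      have "norm (?f x) = min_halving_distance L c / 2" if "x \<in> {a<..<b}" for x
        using circle \<open>a < b\<close> \<open>\<forall>x\<in>{a<..<b}. ?m x = p\<close> that on_sphere(1)[of x] by metis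
      then show ?thesis by (metis power2_norm_eq_inner)
    qed
    obtain S where S: "finite S" "\<And>t. t \<in> {0..L} - S \<Longrightarrow> C1_near c t \<and> C1_near c (t + L/2)"
      using closed_curve_param_C1_near[OF cc] by blast
    \<comment> \<open>The end points join the exceptional set because \<open>orth\<close> is
      available on the open interval only.\<close>
    have deriv: "((\<lambda>x. ?f x \<bullet> ?f x) has_derivative (\<lambda>h. 0)) (at t within {0..L})"
      if "t \<in> {0..L} - (S \<union> {0, L})" for t
    proof -
      have "C1_near ?m t" "C1_near ?f t"
        using S(2)[of t] that midpoint_cstar_C1_near by auto
      then have "((\<lambda>x. ?f x \<bullet> ?f x) has_vector_derivative 0) (at t)"
        by (rule stationary_norm[of _ _ _ "{0<..<L}"]) (use that orth const in auto)
      then show ?thesis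
        by (auto simp: has_vector_derivative_def intro: has_derivative_at_withinI)
    qed
    have cont: "continuous_on {0..L} (\<lambda>x. ?f x \<bullet> ?f x)"
      unfolding sq by (intro continuous_intros closed_curve_param_continuous(1)[OF cc]) simp
    have norm_eq_0: "norm (?f t) = norm (?f 0)" if "t \<in> {0..L}" for t
      using has_derivative_zero_unique_strong_interval[of "S \<union> {0, L}" 0 L "\<lambda>x. ?f x \<bullet> ?f x"
          "?f 0 \<bullet> ?f 0" t] S(1) cont deriv that by (auto simp: norm_eq)
    have "halving_distance L c t = halving_distance L c 0" if "t \<in> {0..<L}" for t
      using norm_eq_0[of t] that by (simp add: halving_distance_eq_norm_cstar)
    then show "constant_halving_distance L c"
      using constant_halving_distance_iff[OF cc] min_halving_distance_attained[OF cc] by metis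
  next
    fix t assume const: "constant_halving_distance L c" and t: "t \<in> {0..<L}"
      and diff: "c differentiable at t" "c differentiable at (t + L/2)"
      and nz: "vector_derivative ?m (at t) \<noteq> 0" "vector_derivative ?f (at t) \<noteq> 0"
    have "?f differentiable at t"
      using diff midpoint_cstar_derivs(2)[of c _ t _ L]
      by (metis differentiableI_vector vector_derivative_works)
    then have "((\<lambda>x. ?f x \<bullet> ?f x) has_vector_derivative 2 * (?f t \<bullet> vector_derivative ?f (at t))) (at t)"
      by (intro inner_self_has_derivative) (simp add: vector_derivative_works)
    \<comment> \<open>Constant halving distance makes the squared norm a constant function, so its
      derivative vanishes and the chord is orthogonal to the derivative of
      \<open>?f\<close>.\<close>
    moreover have "?f x \<bullet> ?f x = (min_halving_distance L c / 2)\<^sup>2" for x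
      by (simp add: sq constant_halving_distance_everywhere[OF cc const])
    ultimately have "((\<lambda>x. (min_halving_distance L c / 2)\<^sup>2) has_vector_derivative
        2 * (?f t \<bullet> vector_derivative ?f (at t))) (at t)"
      by simp
    then have "2 * (?f t \<bullet> vector_derivative ?f (at t)) = 0"
      using vector_derivative_unique_at has_vector_derivative_const by blast
    then have orth: "(c t - c (t + L/2)) \<bullet> vector_derivative ?f (at t) = 0"
      by (simp add: cstar_def)
    \<comment> \<open>A nondegenerate chord is required since \<open>parallel\<close> demands a
      nonzero factor. Injectivity holds on \<open>{0..<L}\<close>, so for \<open>t \<ge> L/2\<close>
      the opposite parameter is taken as \<open>t - L/2\<close>.\<close>
    have "c t \<noteq> c (t + L/2)"
    proof (cases "t < L/2")
      case True
      then show ?thesis using inj_onD[OF inj, of t "t + L/2"] t L by auto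
    next
      case False
      have "c (t - L/2) = c (t + L/2)" using per[of "t - L/2"] by (simp add: add.commute)
      then show ?thesis using inj_onD[OF inj, of t "t - L/2"] t L False by auto
    qed
    then show "chord_tangent_to_midpoint_curve L c t"
      unfolding chord_tangent_to_midpoint_curve_def
      using nz orth midpoint_cstar_derivs_orthogonal[OF assms diff]
      by (intro parallel_if_orthogonal_to_common[of "vector_derivative ?f (at t)"]) auto
  next
    fix t1 t2 t :: real and m
    assume "constant_halving_distance L c" "t \<in> {t1<..<t2}" "\<forall>t\<in>{t1<..<t2}. ?m t = m"
    \<comment> \<open>The centre \<open>m\<close> is the midpoint at \<open>t\<close>, so only the
      radius, half of the constant halving distance, has to be checked.\<close>
    moreover from this have "norm (?f t) = min_halving_distance L c / 2"
      using constant_halving_distance_everywhere[OF cc, of t] by (simp add: halving_distance_eq_norm_cstar)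
    ultimately show "c t \<in> sphere m (min_halving_distance L c / 2)"
      "c (t + L/2) \<in> sphere m (min_halving_distance L c / 2)"
      using on_sphere[of t "min_halving_distance L c / 2"] by auto
  qed
qed

end
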